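(* For each $n$, let $p=p_n$ and let $\mathbf X_1,\ldots,\mathbf X_n$ be i.i.d. $N(\mathbf 0,\boldsymbol\Sigma)$ in $\mathbb R^p$, where $\boldsymbol\Sigma=\boldsymbol\Sigma_p$ has $\Sigma_{ii}=1$ for all $i$. Assume (i) $p/n\to y\in(0,\infty)$ and (ii) $\mathrm{tr}(\boldsymbol\Sigma^2)=o(p^2)$ as $n\to\infty$. Then $$L\big(F^{\tilde{\boldsymbol\rho}_n},F^{\mathbf W_n}\big)\to 0\quad\text{in probability},$$ where $\tilde{\boldsymbol\rho}_n=\frac{3}{n(n-1)(n-2)}\sum^*_{i,j,k}\mathbf A_{ij}\mathbf A_{ik}^\top$ and $\mathbf W_n=\frac3n\sum_{i=1}^n\mathbf A_i\mathbf A_i^\top$.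
   Context: $\mathbf X_i=(x_{i1},\ldots,x_{ip})^\top$. Sign vectors $\mathbf A_{ik}=\mathrm{sign}(\mathbf X_i-\mathbf X_k)$ (coordinatewise sign). $\mathbf A_i=\mathbb E\{\mathbf A_{ik}\mid\mathbf X_i\}$ for $k\ne i$; in the Gaussian setting with unit diagonal, $\mathbf A_i=(2\Phi(x_{i1})-1,\ldots,2\Phi(x_{ip})-1)^\top$ with $\Phi$ the standard normal cdf. $\sum^*$ denotes summation over mutually distinct indices in $\{1,\ldots,n\}$. For a $p\times p$ Hermitian matrix $\mathbf H$ with eigenvalues $\lambda_1,\ldots,\lambda_p$, its empirical spectral distribution is $F^{\mathbf H}(x)=\frac1p\sum_{i}I(\lambda_i\le x)$. $L(\cdot,\cdot)$ is the Lévy distance between distribution functions. *)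

theory Defs
  imports "HOL-Probability.Probability" "HOL-Library.Landau_Symbols"
    "Jordan_Normal_Form.Char_Poly"
begin

definition Phi :: "real \<Rightarrow> real" where
  "Phi x = measure (density lborel std_normal_density) {..x}"

text \<open>Y = (Y 0, ..., Y (p-1)) is a centered Gaussian vector with covariance S
  (Cramer-Wold definition, allowing degenerate S): every linear combination
  c'Y is N(0, c'Sc), where N(0,0) is the point mass at 0.\<close>
definition centered_gaussian_vector ::
  "'a measure \<Rightarrow> nat \<Rightarrow> (nat \<Rightarrow> nat \<Rightarrow> real) \<Rightarrow> (nat \<Rightarrow> 'a \<Rightarrow> real) \<Rightarrow> bool" where
  "centered_gaussian_vector M p S Y \<longleftrightarrow>
     (\<forall>j<p. Y j \<in> borel_measurable M) \<and>
     (\<forall>c :: nat \<Rightarrow> real.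
        let v = (\<Sum>a<p. \<Sum>b<p. c a * S a b * c b);
            Z = (\<lambda>\<omega>. \<Sum>j<p. c j * Y j \<omega>)
        in (v > 0 \<and> distributed M lborel Z (normal_density 0 (sqrt v)))
           \<or> (v = 0 \<and> (AE \<omega> in M. Z \<omega> = 0)))"

definition esd :: "real mat \<Rightarrow> real \<Rightarrow> real" where
  "esd H x = (\<Sum>r\<in>{r. poly (char_poly H) r = 0 \<and> r \<le> x}. real (order r (char_poly H)))
              / real (dim_row H)"

definition levy_dist :: "(real \<Rightarrow> real) \<Rightarrow> (real \<Rightarrow> real) \<Rightarrow> real" where
  "levy_dist F G = Inf {\<epsilon>. \<epsilon> > 0 \<and> (\<forall>x. F (x - \<epsilon>) - \<epsilon> \<le> G x \<and> G x \<le> F (x + \<epsilon>) + \<epsilon>)}"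

text \<open>rho tilde: (3/(n(n-1)(n-2))) sum over distinct i,j,k of A_ij A_ik^T,
  with A_ik = sign(X_i - X_k) coordinatewise. X i a w is coordinate a of X_i.\<close>
definition rho_tilde :: "nat \<Rightarrow> nat \<Rightarrow> (nat \<Rightarrow> nat \<Rightarrow> real) \<Rightarrow> real mat" where
  "rho_tilde n p X = mat p p (\<lambda>(a, b).
     3 / (real n * (real n - 1) * (real n - 2)) *
     (\<Sum>(i, j, k) \<in> {(i, j, k). i < n \<and> j < n \<and> k < n \<and> i \<noteq> j \<and> i \<noteq> k \<and> j \<noteq> k}.
        sgn (X i a - X j a) * sgn (X i b - X k b)))"

text \<open>W_n = (3/n) sum_i A_i A_i^T with A_i = (2 Phi(x_i1) - 1, ..., 2 Phi(x_ip) - 1).\<close>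
definition W_mat :: "nat \<Rightarrow> nat \<Rightarrow> (nat \<Rightarrow> nat \<Rightarrow> real) \<Rightarrow> real mat" where
  "W_mat n p X = mat p p (\<lambda>(a, b).
     3 / real n * (\<Sum>i<n. (2 * Phi (X i a) - 1) * (2 * Phi (X i b) - 1)))"

end

theory Submission
  imports Defs "HOL-Real_Asymp.Real_Asymp"
begin

text \<open>For a symmetric matrix \<open>H\<close> with eigenvalues \<open>l\<^sub>k\<close>, the trace \<open>\<Sum>\<^sub>k max 0 (l\<^sub>k - x)\<close> of the
  positive part of \<open>H - x\<close> is the maximum of \<open>\<Sum>\<^sub>k (u\<^sub>k\<^sup>T H u\<^sub>k - x)\<close> over orthonormal families.  Hence,
  if \<open>\<Sum>\<^sub>k u\<^sub>k\<^sup>T (H - G) u\<^sub>k\<close> is at most \<open>T\<close> in absolute value for all orthonormal families, these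
  traces differ by at most \<open>T\<close>; differencing in \<open>x\<close> with step \<open>\<epsilon>\<close> turns this into a Levy
  distance of at most \<open>\<epsilon>\<close> as soon as \<open>2 T \<le> \<epsilon>\<^sup>2 p\<close>.

  Let \<open>S\<^sub>i\<close> be the mean of \<open>A\<^sub>i\<^sub>j\<close> over \<open>j \<noteq> i\<close>.  Up to terms of order \<open>p / n\<close>, the form
  \<open>u\<^sup>T (\<rho> - W) u\<close> is \<open>3/n \<Sum>\<^sub>i ((S\<^sub>i - A\<^sub>i)\<^sup>T u) ((S\<^sub>i + A\<^sub>i)\<^sup>T u)\<close>, so by Bessel's
  inequality \<open>T / p\<close> is small once \<open>\<Sum>\<^sub>i |S\<^sub>i - A\<^sub>i|\<^sup>2\<close> is small compared to \<open>n p\<close>.  Given \<open>X\<^sub>i\<close>, each coordinate of \<open>S\<^sub>i\<close> is an average of \<open>n - 1\<close> independent signs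
  with mean the corresponding coordinate of \<open>A\<^sub>i\<close>, so this sum has expectation \<open>O(p)\<close>, and Markov's
  inequality concludes.\<close>

subsection \<open>Spectral theorem for real symmetric matrices\<close>

text \<open>The fundamental theorem of algebra supplies a complex eigenvalue \<open>k\<close> of the
  complexified matrix. For an eigenvector \<open>z\<close> the Hermitian form \<open>s\<close>
  equals both its own conjugate and \<open>k\<close> times the squared norm of \<open>z\<close>, so
  \<open>k\<close> is real. It is then a root of the real characteristic polynomial.\<close>

lemma real_symmetric_eigenvector_exists:
  fixes H :: "real mat"
  assumes H: "H \<in> carrier_mat n n" and sym: "transpose_mat H = H" and n: "n > 0"
  obtains v l where "eigenvector H v l"
proof -
  let ?Hc = "map_mat complex_of_real H"
  have Hc: "?Hc \<in> carrier_mat n n" using H by simp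
  have entry_sym: "H $$ (a, b) = H $$ (b, a)" if "a < n" "b < n" for a b
    using sym H that by (metis carrier_matD index_transpose_mat(1))
  have "degree (char_poly ?Hc) = n" using degree_monic_char_poly[OF Hc] by simp
  then have "\<not> constant (poly (char_poly ?Hc))"
    using n by (simp add: constant_degree)
  then obtain k where "poly (char_poly ?Hc) k = 0"
    using fundamental_theorem_of_algebra by blast
  then obtain z where "eigenvector ?Hc z k"
    using eigenvalue_root_char_poly[OF Hc] unfolding eigenvalue_def by blast
  then have z: "z \<in> carrier_vec n" and z0: "z \<noteq> 0\<^sub>v n" and ev: "?Hc *\<^sub>v z = k \<cdot>\<^sub>v z"
    using H unfolding eigenvector_def by auto
  let ?z = "\<lambda>a. vec_index z a"
  have ev': "(\<Sum>b<n. of_real (H $$ (a, b)) * ?z b) = k * ?z a" if "a < n" for a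
  proof -
    have "vec_index (?Hc *\<^sub>v z) a = k * ?z a" using ev that z by simp
    then show ?thesis using that H z by (simp add: scalar_prod_def atLeast0LessThan)
  qed
  define s where "s = (\<Sum>a<n. \<Sum>b<n. cnj (?z a) * of_real (H $$ (a, b)) * ?z b)"
  define N where "N = (\<Sum>a<n. (cmod (?z a))\<^sup>2)"
  \<comment> \<open>Conjugation swaps \<open>z\<close> with its conjugate; symmetry of
    \<open>H\<close> and exchanging the two indices restore the original sum.\<close>
  have "cnj s = (\<Sum>a<n. \<Sum>b<n. ?z a * of_real (H $$ (a, b)) * cnj (?z b))"
    unfolding s_def by simp
  also have "\<dots> = (\<Sum>b<n. \<Sum>a<n. ?z a * of_real (H $$ (a, b)) * cnj (?z b))"
    by (rule sum.swap)
  also have "\<dots> = s" unfolding s_def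
    by (intro sum.cong refl) (simp add: entry_sym)
  finally have "cnj s = s" .
  moreover have s_eq: "s = k * of_real N"
  proof -
    have "s = (\<Sum>a<n. cnj (?z a) * (k * ?z a))"
      unfolding s_def by (intro sum.cong refl) (simp add: ev'[symmetric] sum_distrib_left mult.assoc)
    also have "\<dots> = k * of_real N"
      unfolding N_def of_real_sum sum_distrib_left
      by (intro sum.cong refl) (simp only: complex_norm_square, simp add: mult_ac)
    finally show ?thesis .
  qed
  moreover have "N \<noteq> 0"
  proof
    assume "N = 0"
    then have "\<forall>a<n. ?z a = 0" unfolding N_def by (simp add: sum_nonneg_eq_0_iff)
    then have "z = 0\<^sub>v n" using z by (intro eq_vecI) auto
    with z0 show False ..
  qed
  ultimately have "k \<in> \<real>"
    by (metis Reals_cnj_iff complex_cnj_complex_of_real complex_cnj_mult mult_right_cancel of_real_eq_0_iff)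
  then obtain l where l: "k = of_real l" by (auto elim: Reals_cases)
  have "poly (char_poly H) l = 0"
    using \<open>poly (char_poly ?Hc) k = 0\<close>
    unfolding l of_real_hom.char_poly_hom[OF H] by simp
  then show ?thesis
    using that eigenvalue_root_char_poly[OF H] unfolding eigenvalue_def by blast
qed

lemma sum_of_bool_eq:
  fixes f :: "nat \<Rightarrow> real"
  assumes "j < n"
  shows "(\<Sum>k<n. of_bool (j = k) * f k) = f j" "(\<Sum>k<n. of_bool (k = j) * f k) = f j"
  using assms by (simp_all add: of_bool_def if_distrib[of "\<lambda>t. t * _"] cong: if_cong)

text \<open>The reflection in the hyperplane orthogonal to \<open>w\<close>, the difference of
  \<open>u\<close> and the first unit vector, exchanges these two unit vectors. Its first column is
  therefore \<open>u\<close>.\<close>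

lemma householder_reflection:
  fixes u :: "nat \<Rightarrow> real"
  assumes n: "n > 0" and u: "(\<Sum>a<n. (u a)\<^sup>2) = 1"
  obtains Q where "Q \<in> carrier_mat n n" "transpose_mat Q = Q" "Q * Q = 1\<^sub>m n"
    "\<And>a. a < n \<Longrightarrow> Q $$ (a, 0) = u a"
proof -
  define w where "w a = u a - of_bool (a = 0)" for a
  define s where "s = 2 - 2 * u 0"
  have ww: "(\<Sum>a<n. w a * w a) = s"
  proof -
    have "(\<Sum>a<n. w a * w a) = (\<Sum>a<n. (u a)\<^sup>2 + (if a = 0 then 1 - 2 * u a else 0))"
      by (intro sum.cong refl) (auto simp: w_def power2_eq_square algebra_simps)
    also have "\<dots> = s" using n by (simp add: sum.distrib u s_def)
    finally show ?thesis .
  qed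
  \<comment> \<open>In the degenerate case where \<open>u\<close> is the first unit vector,
    \<open>s = 0\<close>, so \<open>2 / s\<close> is 0 and \<open>q\<close> is the identity, which
    is still correct.\<close>
  define q where "q a b = of_bool (a = b) - 2 / s * (w a * w b)" for a b :: nat
  define Q where "Q = Matrix.mat n n (\<lambda>(a, b). q a b)"
  have Q: "Q \<in> carrier_mat n n" unfolding Q_def by simp
  have qq: "(\<Sum>c<n. q a c * q c b) = of_bool (a = b)" if ab: "a < n" "b < n" for a b
  proof -
    have "(\<Sum>c<n. q a c * q c b) = (\<Sum>c<n. of_bool (a = c) * of_bool (c = b)
        - 2 / s * (of_bool (a = c) * (w c * w b)) - 2 / s * (of_bool (c = b) * (w a * w c))
        + (2 / s)\<^sup>2 * w a * w b * (w c * w c))"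
      by (intro sum.cong refl) (simp add: q_def power2_eq_square algebra_simps)
    also have "\<dots> = of_bool (a = b) - 4 / s * (w a * w b) + (2 / s)\<^sup>2 * w a * w b * s"
      by (simp only: sum.distrib sum_subtractf sum_distrib_left[symmetric] sum_of_bool_eq ab ww)
    also have "\<dots> = of_bool (a = b)"
      by (cases "s = 0") (simp_all add: power2_eq_square field_simps)
    finally show ?thesis .
  qed
  show ?thesis
  proof
    show "Q \<in> carrier_mat n n" by fact
    show "transpose_mat Q = Q"
      by (rule eq_matI) (auto simp: Q_def q_def mult_ac)
    show "Q * Q = 1\<^sub>m n"
    proof (rule eq_matI)
      fix a b assume "a < dim_row (1\<^sub>m n :: real mat)" "b < dim_col (1\<^sub>m n :: real mat)"
      then have ab: "a < n" "b < n" by auto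
      then have "(Q * Q) $$ (a, b) = (\<Sum>c<n. q a c * q c b)"
        by (simp add: Q_def scalar_prod_def atLeast0LessThan)
      then show "(Q * Q) $$ (a, b) = 1\<^sub>m n $$ (a, b)" using qq ab by simp
    qed (use Q in auto)
    fix a assume a: "a < n"
    show "Q $$ (a, 0) = u a"
    proof (cases "s = 0")
      case True
      then have "w a = 0" using ww a by (simp add: sum_nonneg_eq_0_iff)
      then show ?thesis using a n by (simp add: Q_def q_def w_def)
    next
      case False
      \<comment> \<open>With this value the factor \<open>- 2 / s * w 0\<close> is 1, so column 0 is
        the first unit vector plus \<open>w\<close>, which is \<open>u\<close>.\<close>
      have "w 0 = - s / 2" by (simp add: w_def s_def)
      then have "q a 0 = of_bool (a = 0) + w a" using False by (simp add: q_def)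
      then show ?thesis using a n by (simp add: Q_def w_def)
    qed
  qed
qed

text \<open>Deflation by induction on the dimension: conjugating with a reflection whose first
  column is a unit eigenvector splits off a 1 by 1 block, and the induction hypothesis diagonalizes
  the remaining symmetric block.\<close>

lemma real_symmetric_diagonalizable:
  fixes H :: "real mat"
  assumes "H \<in> carrier_mat n n" and "transpose_mat H = H"
  obtains Q where "Q \<in> carrier_mat n n" "transpose_mat Q * Q = 1\<^sub>m n"
    "diagonal_mat (transpose_mat Q * H * Q)"
  using assms
proof (induction n arbitrary: H thesis)
  case 0
  show ?case
    by (rule "0.prems"(1)[of "1\<^sub>m 0"]) (use 0 in \<open>auto simp: diagonal_mat_def\<close>)
next
  case (Suc m)
  let ?n = "Suc m"
  note H = Suc.prems(2) and sym = Suc.prems(3)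
  obtain v l where "eigenvector H v l"
    using real_symmetric_eigenvector_exists[OF H sym] by blast
  then have v: "v \<in> carrier_vec ?n" and v0: "v \<noteq> 0\<^sub>v ?n" and ev: "H *\<^sub>v v = l \<cdot>\<^sub>v v"
    using H unfolding eigenvector_def by auto
  define N where "N = (\<Sum>a<?n. (vec_index v a)\<^sup>2)"
  have "N > 0"
  proof -
    obtain a where "a < ?n" "vec_index v a \<noteq> 0"
      using v v0 by (metis carrier_vecD eq_vecI index_zero_vec(1) index_zero_vec(2))
    then show ?thesis unfolding N_def by (intro sum_pos2[of _ a]) auto
  qed
  define u where "u a = vec_index v a / sqrt N" for a
  have uu: "(\<Sum>a<?n. (u a)\<^sup>2) = 1"
    using \<open>N > 0\<close> by (simp add: u_def power_divide N_def flip: sum_divide_distrib)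
  obtain Q where Q: "Q \<in> carrier_mat ?n ?n" and Qt: "transpose_mat Q = Q"
    and QQ: "Q * Q = 1\<^sub>m ?n" and Qu: "\<And>a. a < ?n \<Longrightarrow> Q $$ (a, 0) = u a"
    using householder_reflection[OF _ uu] by blast
  have Hu: "(\<Sum>b<?n. H $$ (a, b) * u b) = l * u a" if "a < ?n" for a
  proof -
    have "vec_index (H *\<^sub>v v) a = l * vec_index v a" using ev that v by simp
    then have "(\<Sum>b<?n. H $$ (a, b) * vec_index v b) = l * vec_index v a"
      using that H v by (simp add: scalar_prod_def atLeast0LessThan del: sum.lessThan_Suc)
    then show ?thesis by (simp add: u_def del: sum.lessThan_Suc flip: sum_divide_distrib)
  qed
  define B where "B = Q * H * Q"
  have B: "B \<in> carrier_mat ?n ?n" unfolding B_def using Q H by simp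
  have Bt: "transpose_mat B = B"
    unfolding B_def using Q H
    by (subst transpose_mult[of _ ?n ?n _ ?n], simp, simp,
        subst transpose_mult[of _ ?n ?n _ ?n], simp, simp) (simp add: Qt sym assoc_mult_mat[of _ ?n ?n _ ?n _ ?n])
  \<comment> \<open>Column 0 of \<open>H * Q\<close> is \<open>l\<close> times column 0 of
    \<open>Q\<close>, because that column is an eigenvector; \<open>Q * Q = 1\<close> then gives a
    multiple of the first unit vector.\<close>
  have B0: "B $$ (a, 0) = l * of_bool (a = 0)" if a: "a < ?n" for a
  proof -
    have HQ: "(H * Q) $$ (c, 0) = l * Q $$ (c, 0)" if "c < ?n" for c
      using that H Q Hu[OF that] Qu
      by (simp add: scalar_prod_def atLeast0LessThan del: sum.lessThan_Suc)
    have "B $$ (a, 0) = (Q * (H * Q)) $$ (a, 0)"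
      unfolding B_def using Q H by (simp add: assoc_mult_mat[of _ ?n ?n _ ?n _ ?n])
    also have "\<dots> = (\<Sum>c<?n. Q $$ (a, c) * (H * Q) $$ (c, 0))"
      using Q H a by (simp add: scalar_prod_def atLeast0LessThan del: sum.lessThan_Suc)
    also have "\<dots> = (\<Sum>c<?n. Q $$ (a, c) * (l * Q $$ (c, 0)))"
      by (intro sum.cong refl) (simp only: HQ lessThan_iff)
    also have "\<dots> = l * (Q * Q) $$ (a, 0)"
      using Q a by (simp add: scalar_prod_def atLeast0LessThan sum_distrib_left mult_ac del: sum.lessThan_Suc)
    also have "\<dots> = l * of_bool (a = 0)" using a by (simp add: QQ)
    finally show ?thesis .
  qed
  have B0': "B $$ (0, a) = l * of_bool (a = 0)" if a: "a < ?n" for a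
    using B0[OF a] Bt B a by (metis carrier_matD index_transpose_mat(1) zero_less_Suc)
  define C where "C = Matrix.mat m m (\<lambda>(i, j). B $$ (Suc i, Suc j))"
  have C: "C \<in> carrier_mat m m" unfolding C_def by simp
  have "transpose_mat C = C"
  proof (rule eq_matI)
    fix i j assume "i < dim_row C" "j < dim_col C"
    then show "transpose_mat C $$ (i, j) = C $$ (i, j)"
      using B Bt index_transpose_mat(1)[of "Suc i" B "Suc j"] by (auto simp: C_def)
  qed (simp_all add: C_def)
  then obtain R where R: "R \<in> carrier_mat m m" and RR: "transpose_mat R * R = 1\<^sub>m m"
    and diag: "diagonal_mat (transpose_mat R * C * R)"
    using Suc.IH[OF _ C] by blast
  define L where "L = Matrix.mat 1 1 (\<lambda>_. l)"
  have L: "L \<in> carrier_mat 1 1" unfolding L_def by simp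
  have B_block: "B = four_block_mat L (0\<^sub>m 1 m) (0\<^sub>m m 1) C"
    using B by (intro eq_matI) (auto simp: L_def C_def B0 B0' split: nat_diff_split)
  define P where "P = four_block_mat (1\<^sub>m 1) (0\<^sub>m 1 m) (0\<^sub>m m 1) R"
  have P: "P \<in> carrier_mat ?n ?n" unfolding P_def using four_block_carrier_mat[of "1\<^sub>m 1" 1 1 R m m] R by simp
  have Pt: "transpose_mat P = four_block_mat (1\<^sub>m 1) (0\<^sub>m 1 m) (0\<^sub>m m 1) (transpose_mat R)"
    unfolding P_def using R by (subst transpose_four_block_mat[of _ 1 1 _ m _ m]) auto
  have PP: "transpose_mat P * P = 1\<^sub>m ?n"
    unfolding Pt unfolding P_def
    using R RR four_block_one_mat[of 1 m, where ?'a = real]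
    by (subst mult_four_block_mat[of _ 1 1 _ m _ m _ _ 1 _ m]) simp_all
  have PBP: "transpose_mat P * B * P = four_block_mat L (0\<^sub>m 1 m) (0\<^sub>m m 1) (transpose_mat R * C * R)"
    unfolding Pt unfolding P_def B_block
    using R C L by (subst mult_four_block_mat[of _ 1 1 _ m _ m _ _ 1 _ m], simp_all)
      (subst mult_four_block_mat[of _ 1 1 _ m _ m _ _ 1 _ m], simp_all)
  show ?case
  proof (rule Suc.prems(1)[of "Q * P"])
    show "Q * P \<in> carrier_mat ?n ?n" using Q P by simp
    have t: "transpose_mat (Q * P) = transpose_mat P * Q"
      using transpose_mult[OF Q P] Qt by simp
    have "transpose_mat (Q * P) * (Q * P) = transpose_mat P * ((Q * Q) * P)"
      unfolding t using Q P
      by (simp add: assoc_mult_mat[of _ ?n ?n _ ?n _ ?n])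
    then show "transpose_mat (Q * P) * (Q * P) = 1\<^sub>m ?n" using PP P QQ by simp
    have "transpose_mat (Q * P) * H * (Q * P) = transpose_mat P * B * P"
      unfolding t B_def using Q P H by (simp add: assoc_mult_mat[of _ ?n ?n _ ?n _ ?n])
    moreover have "diagonal_mat (four_block_mat L (0\<^sub>m 1 m) (0\<^sub>m m 1) E)"
      if "diagonal_mat E" "E \<in> carrier_mat m m" for E
    proof -
      have "i = j" if "i < m" "j < m" "E $$ (i, j) \<noteq> 0" for i j
        using \<open>diagonal_mat E\<close> \<open>E \<in> carrier_mat m m\<close> that unfolding diagonal_mat_def by auto
      then show ?thesis
        using that(2) L unfolding diagonal_mat_def by (auto simp: less_Suc_eq_0_disj)
    qed
    ultimately show "diagonal_mat (transpose_mat (Q * P) * H * (Q * P))"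
      using diag R C unfolding PBP by simp
  qed
qed

text \<open>The first family of identities is orthonormality; the second is completeness, the form
  in which \<open>parseval\<close> uses it.\<close>

definition orthonormal_basis :: "nat \<Rightarrow> (nat \<Rightarrow> nat \<Rightarrow> real) \<Rightarrow> bool" where
  "orthonormal_basis n u \<longleftrightarrow>
    (\<forall>j<n. \<forall>k<n. (\<Sum>a<n. u j a * u k a) = of_bool (j = k)) \<and>
    (\<forall>a<n. \<forall>b<n. (\<Sum>k<n. u k a * u k b) = of_bool (a = b))"

text \<open>The spectral decomposition is written entrywise instead of as eigenvector equations, so
  that quadratic forms expand by rearranging finite sums.\<close>

definition eigenbasis :: "nat \<Rightarrow> real mat \<Rightarrow> (nat \<Rightarrow> nat \<Rightarrow> real) \<Rightarrow> (nat \<Rightarrow> real) \<Rightarrow> bool" where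
  "eigenbasis n H u l \<longleftrightarrow> orthonormal_basis n u \<and>
    (\<forall>a<n. \<forall>b<n. H $$ (a, b) = (\<Sum>k<n. l k * (u k a * u k b)))"

text \<open>The basis consists of the columns of the diagonalizing matrix. The factorization of the
  characteristic polynomial is recorded along with it, because \<open>esd\<close> is defined through
  root multiplicities.\<close>

theorem real_symmetric_eigenbasis:
  fixes H :: "real mat"
  assumes H: "H \<in> carrier_mat n n" and sym: "transpose_mat H = H"
  obtains u l where "eigenbasis n H u l" "char_poly H = (\<Prod>k<n. [:- l k, 1:])"
proof -
  obtain Q where Q: "Q \<in> carrier_mat n n" and QtQ: "transpose_mat Q * Q = 1\<^sub>m n"
    and diag: "diagonal_mat (transpose_mat Q * H * Q)"
    using real_symmetric_diagonalizable[OF H sym] .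
  define D where "D = transpose_mat Q * H * Q"
  have Qt: "transpose_mat Q \<in> carrier_mat n n" using Q by simp
  have D: "D \<in> carrier_mat n n" unfolding D_def using Q H by simp
  \<comment> \<open>A left inverse of a square matrix is also a right inverse; this is the
    completeness of the columns.\<close>
  have QQt: "Q * transpose_mat Q = 1\<^sub>m n" using mat_mult_left_right_inverse[OF Qt Q QtQ] .
  have HD: "H = Q * D * transpose_mat Q"
  proof -
    have "Q * D * transpose_mat Q = (Q * transpose_mat Q) * H * (Q * transpose_mat Q)"
      unfolding D_def using Q H Qt by (simp add: assoc_mult_mat[of _ n n _ n _ n])
    then show ?thesis using H by (simp add: QQt)
  qed
  define u where "u k a = Q $$ (a, k)" for k a
  define l where "l k = D $$ (k, k)" for k
  have D_entry: "D $$ (j, k) = (if j = k then l k else 0)" if "j < n" "k < n" for j k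
    using diag that D unfolding D_def[symmetric] diagonal_mat_def l_def by auto
  show ?thesis
  proof
    show "eigenbasis n H u l"
      unfolding eigenbasis_def orthonormal_basis_def
    proof (intro conjI allI impI)
      fix j k assume jk: "j < n" "k < n"
      have "(transpose_mat Q * Q) $$ (j, k) = (\<Sum>a<n. u j a * u k a)"
        using Q jk by (simp add: scalar_prod_def u_def atLeast0LessThan)
      then show "(\<Sum>a<n. u j a * u k a) = of_bool (j = k)" using jk unfolding QtQ by (cases "j = k") simp_all
      have "(Q * transpose_mat Q) $$ (j, k) = (\<Sum>a<n. u a j * u a k)"
        using Q jk by (simp add: scalar_prod_def u_def atLeast0LessThan)
      then show "(\<Sum>a<n. u a j * u a k) = of_bool (j = k)" using jk unfolding QQt by (cases "j = k") simp_all
      have mult_transpose: "(E * transpose_mat Q) $$ (j, k) = (\<Sum>i<n. E $$ (j, i) * Q $$ (k, i))"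
        if "E \<in> carrier_mat n n" "j < n" "k < n" for E j k
        using Q that by (simp add: scalar_prod_def atLeast0LessThan)
      have "(Q * D) $$ (j, i) = u i j * l i" if "i < n" for i
        using Q D jk that by (simp add: scalar_prod_def u_def atLeast0LessThan D_entry
            if_distrib[of "\<lambda>t. _ * t"] cong: if_cong)
      then have "(Q * D * transpose_mat Q) $$ (j, k) = (\<Sum>i<n. l i * (u i j * u i k))"
        using mult_transpose[of "Q * D" j k] Q D jk by (simp add: u_def mult_ac del: index_mult_mat(1))
      then show "H $$ (j, k) = (\<Sum>i<n. l i * (u i j * u i k))" by (simp flip: HD)
    qed
    have "similar_mat H D"
      unfolding similar_mat_def similar_mat_wit_def Let_def
      using H D Q Qt QQt QtQ HD by (intro exI[of _ Q] exI[of _ "transpose_mat Q"]) auto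
    moreover have "upper_triangular D" using D D_entry by (auto simp: upper_triangular_def)
    ultimately have "char_poly H = (\<Prod>a\<leftarrow>diag_mat D. [:- a, 1:])"
      using char_poly_similar[of H D] char_poly_upper_triangular[OF D] by simp
    also have "\<dots> = (\<Prod>k<n. [:- l k, 1:])"
      using D by (simp add: diag_mat_def l_def prod.distinct_set_conv_list[symmetric] atLeast0LessThan comp_def)
    finally show "char_poly H = (\<Prod>k<n. [:- l k, 1:])" .
  qed
qed

subsection \<open>Perturbation of the empirical spectral distribution\<close>

lemma orthonormal_basisD:
  assumes "orthonormal_basis n u"
  shows "j < n \<Longrightarrow> k < n \<Longrightarrow> (\<Sum>a<n. u j a * u k a) = of_bool (j = k)"
    and "a < n \<Longrightarrow> b < n \<Longrightarrow> (\<Sum>k<n. u k a * u k b) = of_bool (a = b)"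
  using assms unfolding orthonormal_basis_def by blast+

lemma parseval:
  assumes "orthonormal_basis n u"
  shows "(\<Sum>k<n. (\<Sum>a<n. u k a * w a)\<^sup>2) = (\<Sum>a<n. (w a)\<^sup>2)"
proof -
  have "(\<Sum>k<n. (\<Sum>a<n. u k a * w a)\<^sup>2)
      = (\<Sum>k<n. \<Sum>a<n. \<Sum>b<n. (u k a * u k b) * (w a * w b))"
    by (intro sum.cong refl) (simp add: power2_eq_square sum_product mult_ac)
  also have "\<dots> = (\<Sum>a<n. \<Sum>k<n. \<Sum>b<n. (u k a * u k b) * (w a * w b))" by (rule sum.swap)
  also have "\<dots> = (\<Sum>a<n. \<Sum>b<n. \<Sum>k<n. (u k a * u k b) * (w a * w b))"
    by (intro sum.cong refl sum.swap)
  also have "\<dots> = (\<Sum>a<n. \<Sum>b<n. of_bool (a = b) * (w a * w b))"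
    by (intro sum.cong refl) (simp only: sum_distrib_right[symmetric] orthonormal_basisD(2)[OF assms] lessThan_iff)
  also have "\<dots> = (\<Sum>a<n. (w a)\<^sup>2)"
    by (intro sum.cong refl) (simp only: sum_of_bool_eq lessThan_iff power2_eq_square)
  finally show ?thesis .
qed

lemma bessel:
  assumes "orthonormal_basis n u" "K \<subseteq> {..<n}"
  shows "(\<Sum>k\<in>K. (\<Sum>a<n. u k a * w a)\<^sup>2) \<le> (\<Sum>a<n. (w a)\<^sup>2)"
  unfolding parseval[OF assms(1), of w, symmetric] using assms(2) by (intro sum_mono2) auto

definition quad_form :: "nat \<Rightarrow> real mat \<Rightarrow> (nat \<Rightarrow> real) \<Rightarrow> real" where
  "quad_form n H v = (\<Sum>a<n. \<Sum>b<n. v a * H $$ (a, b) * v b)"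

lemma quad_form_eigenbasis:
  assumes "eigenbasis n H u l"
  shows "quad_form n H v = (\<Sum>k<n. l k * (\<Sum>a<n. u k a * v a)\<^sup>2)"
proof -
  have "quad_form n H v = (\<Sum>a<n. \<Sum>b<n. \<Sum>k<n. l k * ((u k a * v a) * (u k b * v b)))"
    using assms unfolding quad_form_def eigenbasis_def
    by (intro sum.cong refl) (simp add: sum_distrib_left sum_distrib_right mult_ac)
  also have "\<dots> = (\<Sum>a<n. \<Sum>k<n. \<Sum>b<n. l k * ((u k a * v a) * (u k b * v b)))"
    by (intro sum.cong refl sum.swap)
  also have "\<dots> = (\<Sum>k<n. \<Sum>a<n. \<Sum>b<n. l k * ((u k a * v a) * (u k b * v b)))"
    by (rule sum.swap)
  also have "\<dots> = (\<Sum>k<n. l k * (\<Sum>a<n. u k a * v a)\<^sup>2)"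
    by (intro sum.cong refl) (simp only: power2_eq_square sum_product, simp only: sum_distrib_left)
  finally show ?thesis .
qed

lemma quad_form_eigenvector:
  assumes "eigenbasis n H u l" "j < n"
  shows "quad_form n H (u j) = l j"
proof -
  have "orthonormal_basis n u" using assms(1) unfolding eigenbasis_def by simp
  then have "quad_form n H (u j) = (\<Sum>k<n. l k * (of_bool (k = j))\<^sup>2)"
    unfolding quad_form_eigenbasis[OF assms(1)]
    by (intro sum.cong refl) (simp only: orthonormal_basisD(1) assms(2) lessThan_iff)
  also have "\<dots> = (\<Sum>k<n. of_bool (k = j) * l k)"
    by (intro sum.cong refl) (simp add: mult.commute)
  finally show ?thesis using sum_of_bool_eq(2)[OF assms(2)] by simp
qed

text \<open>The upper-bound half of a Ky Fan variational principle. In the eigenbasis of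
  \<open>G\<close> each \<open>m j - x\<close> receives the weight \<Sum>k\<in>K of the squared
  inner products of \<open>u k\<close> and \<open>v j\<close>. By Bessel's inequality this weight
  lies between 0 and 1, so the weighted term is at most the positive part.\<close>

lemma quad_form_sum_le_trace_pos_part:
  assumes G: "eigenbasis n G v m" and u: "orthonormal_basis n u" and K: "K \<subseteq> {..<n}"
  shows "(\<Sum>k\<in>K. quad_form n G (u k) - x) \<le> (\<Sum>j<n. max 0 (m j - x))"
proof -
  have v: "orthonormal_basis n v" using G unfolding eigenbasis_def by simp
  have unit: "(\<Sum>a<n. (u k a)\<^sup>2) = 1" "(\<Sum>a<n. (v k a)\<^sup>2) = 1" if "k < n" for k
    using orthonormal_basisD(1)[OF u that that] orthonormal_basisD(1)[OF v that that]
    by (simp_all add: power2_eq_square)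
  let ?c = "\<lambda>k j. (\<Sum>a<n. v j a * u k a)\<^sup>2"
  have "quad_form n G (u k) - x = (\<Sum>j<n. (m j - x) * ?c k j)" if "k < n" for k
  proof -
    \<comment> \<open>Since the weights of one \<open>u k\<close> sum to 1, the shift
      \<open>x\<close> can be distributed over the eigenvalues.\<close>
    have "(\<Sum>j<n. ?c k j) = 1" using parseval[OF v, of "u k"] unit(1)[OF that] by simp
    then show ?thesis
      by (simp add: quad_form_eigenbasis[OF G] left_diff_distrib sum_subtractf flip: sum_distrib_left)
  qed
  then have "(\<Sum>k\<in>K. quad_form n G (u k) - x) = (\<Sum>k\<in>K. \<Sum>j<n. (m j - x) * ?c k j)"
    using K by (intro sum.cong refl) auto
  also have "\<dots> = (\<Sum>j<n. (m j - x) * (\<Sum>k\<in>K. ?c k j))"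
    unfolding sum_distrib_left by (rule sum.swap)
  also have "\<dots> \<le> (\<Sum>j<n. max 0 (m j - x))"
  proof (rule sum_mono)
    fix j assume "j \<in> {..<n}"
    then have "(\<Sum>k\<in>K. ?c k j) \<le> 1"
      using bessel[OF u K, of "v j"] unit(2)[of j] by (simp add: mult.commute)
    moreover have "0 \<le> (\<Sum>k\<in>K. ?c k j)" by (simp add: sum_nonneg)
    ultimately show "(m j - x) * (\<Sum>k\<in>K. ?c k j) \<le> max 0 (m j - x)"
      by (cases "m j \<le> x") (auto simp: max_def mult_nonpos_nonneg intro: mult_left_le)
  qed
  finally show ?thesis .
qed

text \<open>The eigenvectors of \<open>H\<close> with eigenvalue above \<open>x\<close> attain the
  variational maximum for \<open>H\<close>. The same family is only a competitor for
  \<open>G\<close>, so the two maxima differ by at most \<open>T\<close> in this direction.\<close>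

lemma trace_pos_part_perturbation:
  assumes H: "eigenbasis n H u l" and G: "eigenbasis n G v m"
    and T: "\<And>K. K \<subseteq> {..<n} \<Longrightarrow> (\<Sum>k\<in>K. quad_form n H (u k) - quad_form n G (u k)) \<le> T"
  shows "(\<Sum>k<n. max 0 (l k - x)) \<le> (\<Sum>k<n. max 0 (m k - x)) + T"
proof -
  define K where "K = {k. k < n \<and> x < l k}"
  have K: "K \<subseteq> {..<n}" unfolding K_def by auto
  have u: "orthonormal_basis n u" using H unfolding eigenbasis_def by simp
  have "(\<Sum>k<n. max 0 (l k - x)) = (\<Sum>k\<in>K. l k - x)"
    by (intro sum.mono_neutral_cong_right) (auto simp: K_def)
  also have "\<dots> = (\<Sum>k\<in>K. quad_form n H (u k) - quad_form n G (u k)) + (\<Sum>k\<in>K. quad_form n G (u k) - x)"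
    using quad_form_eigenvector[OF H] K unfolding sum.distrib[symmetric] by (intro sum.cong) auto
  also have "\<dots> \<le> T + (\<Sum>k<n. max 0 (m k - x))"
    by (intro add_mono T K quad_form_sum_le_trace_pos_part[OF G u])
  finally show ?thesis by simp
qed


text \<open>As a function of t, \<epsilon> minus the difference of the positive parts of t - x and t
  - (x + \<epsilon>) is a ramp: it equals \<epsilon> up to x and falls linearly to 0 at x +
  \<epsilon>. It lies between \<epsilon> times the indicators of t \<le> x and t \<le> x +
  \<epsilon>. The ramp sums for \<open>m\<close> and \<open>l\<close> involve two traces each,
  whence the error \<open>2 * T\<close>; dividing by \<epsilon> finishes.\<close>

lemma eigenvalue_count_perturbation:
  fixes l m :: "nat \<Rightarrow> real"
  assumes \<epsilon>: "\<epsilon> > 0"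
    and lm: "\<And>x. (\<Sum>k<n. max 0 (l k - x)) \<le> (\<Sum>k<n. max 0 (m k - x)) + T"
    and ml: "\<And>x. (\<Sum>k<n. max 0 (m k - x)) \<le> (\<Sum>k<n. max 0 (l k - x)) + T"
    and T: "2 * T \<le> \<epsilon>\<^sup>2 * real n"
  shows "real (card {k. k < n \<and> m k \<le> x}) \<le> real (card {k. k < n \<and> l k \<le> x + \<epsilon>}) + \<epsilon> * real n"
proof -
  have count: "real (card {k. k < n \<and> P k}) = (\<Sum>k<n. of_bool (P k))" for P
    by (simp add: of_bool_def sum.If_cases lessThan_def Collect_conj_eq)
  let ?l = "\<lambda>x. \<Sum>k<n. max 0 (l k - x)" and ?m = "\<lambda>x. \<Sum>k<n. max 0 (m k - x)"
  have "\<epsilon> * (\<Sum>k<n. of_bool (m k \<le> x)) \<le> (\<Sum>k<n. \<epsilon> - (max 0 (m k - x) - max 0 (m k - (x + \<epsilon>))))"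
    unfolding sum_distrib_left using \<epsilon> by (intro sum_mono) (auto simp: max_def)
  also have "\<dots> = \<epsilon> * real n - (?m x - ?m (x + \<epsilon>))" by (simp add: sum_subtractf)
  also have "\<dots> \<le> \<epsilon> * real n - (?l x - ?l (x + \<epsilon>)) + 2 * T"
    using lm[of x] ml[of "x + \<epsilon>"] by simp
  also have "\<dots> = (\<Sum>k<n. \<epsilon> - (max 0 (l k - x) - max 0 (l k - (x + \<epsilon>)))) + 2 * T"
    by (simp add: sum_subtractf)
  also have "\<dots> \<le> \<epsilon> * (\<Sum>k<n. of_bool (l k \<le> x + \<epsilon>)) + \<epsilon>\<^sup>2 * real n"
    unfolding sum_distrib_left using \<epsilon> by (intro add_mono sum_mono T) (auto simp: max_def)
  also have "\<dots> = \<epsilon> * ((\<Sum>k<n. of_bool (l k \<le> x + \<epsilon>)) + \<epsilon> * real n)"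
    by (simp add: power2_eq_square algebra_simps)
  finally show ?thesis unfolding count using \<epsilon> by simp
qed

text \<open>The multiplicity of a root is the number of indices \<open>k\<close> with that value of
  \<open>l k\<close>, so grouping the indices by value turns the sum of multiplicities into a count
  of indices.\<close>

lemma esd_eq_card:
  assumes H: "H \<in> carrier_mat n n" and cp: "char_poly H = (\<Prod>k<n. [:- l k, 1:])"
  shows "esd H x = real (card {k. k < n \<and> l k \<le> x}) / real n"
proof -
  have char_poly_nz: "char_poly H \<noteq> 0" unfolding cp by simp
  have "proots (char_poly H) = (\<Sum>k<n. {#l k#})"
    unfolding cp by (subst proots_prod) auto
  then have order: "order r (char_poly H) = card {k. k < n \<and> l k = r}" for r
  proof -
    have "order r (char_poly H) = count (proots (char_poly H)) r" by (simp add: char_poly_nz)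
    also have "\<dots> = (\<Sum>k<n. if l k = r then 1 else 0)"
      using \<open>proots (char_poly H) = _\<close> by (auto simp: count_sum intro!: sum.cong)
    finally show ?thesis by (simp add: sum.If_cases lessThan_def Collect_conj_eq)
  qed
  have roots: "{r. poly (char_poly H) r = 0 \<and> r \<le> x} = l ` {k. k < n \<and> l k \<le> x}" (is "?R = l ` ?K")
    unfolding cp by (auto simp: poly_prod)
  have "card ?K = (\<Sum>r\<in>l ` ?K. card {k\<in>?K. l k = r})"
    by (subst card_eq_sum, subst sum.image_gen[of _ _ l]) auto
  also have "\<dots> = (\<Sum>r\<in>l ` ?K. order r (char_poly H))"
    unfolding order by (intro sum.cong refl arg_cong[where f = card]) auto
  finally show ?thesis using H unfolding esd_def roots by simp
qed

text \<open>The bound is required for all orthonormal bases because it is applied to the eigenbasis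
  of \<open>H\<close> and to that of \<open>G\<close>, one for each direction. The counting lemma at
  \<open>x\<close> gives the upper Levy inequality; with the roles exchanged, at
  \<open>x - \<epsilon>\<close>, it gives the lower one.\<close>

theorem levy_dist_esd_le:
  fixes H G :: "real mat"
  assumes H: "H \<in> carrier_mat n n" "transpose_mat H = H"
    and G: "G \<in> carrier_mat n n" "transpose_mat G = G"
    and \<epsilon>: "\<epsilon> > 0" and T: "2 * T \<le> \<epsilon>\<^sup>2 * real n"
    and bound: "\<And>u K. orthonormal_basis n u \<Longrightarrow> K \<subseteq> {..<n} \<Longrightarrow>
      \<bar>\<Sum>k\<in>K. quad_form n H (u k) - quad_form n G (u k)\<bar> \<le> T"
  shows "levy_dist (esd H) (esd G) \<le> \<epsilon>"
proof -
  obtain u l where u: "eigenbasis n H u l" and l: "char_poly H = (\<Prod>k<n. [:- l k, 1:])"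
    using real_symmetric_eigenbasis[OF H] .
  obtain v m where v: "eigenbasis n G v m" and m: "char_poly G = (\<Prod>k<n. [:- m k, 1:])"
    using real_symmetric_eigenbasis[OF G] .
  have ob: "orthonormal_basis n u" "orthonormal_basis n v"
    using u v unfolding eigenbasis_def by auto
  have lm: "(\<Sum>k<n. max 0 (l k - x)) \<le> (\<Sum>k<n. max 0 (m k - x)) + T" for x
    using bound[OF ob(1)] by (intro trace_pos_part_perturbation[OF u v]) (simp add: abs_le_iff)
  have ml: "(\<Sum>k<n. max 0 (m k - x)) \<le> (\<Sum>k<n. max 0 (l k - x)) + T" for x
    using bound[OF ob(2)]
    by (intro trace_pos_part_perturbation[OF v u]) (simp add: abs_le_iff flip: sum_negf)
  \<comment> \<open>For \<open>n = 0\<close> both quotients are 0 by convention, and \<epsilon> > 0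
    suffices.\<close>
  have le: "a / real n \<le> b / real n + \<epsilon>" if "a \<le> b + \<epsilon> * real n" for a b
  proof (cases "n = 0")
    case False
    then show ?thesis using that by (simp add: field_simps)
  qed (use \<epsilon> in simp)
  have "esd H (x - \<epsilon>) - \<epsilon> \<le> esd G x \<and> esd G x \<le> esd H (x + \<epsilon>) + \<epsilon>" for x
    using le[OF eigenvalue_count_perturbation[OF \<epsilon> lm ml T, of x]]
      le[OF eigenvalue_count_perturbation[OF \<epsilon> ml lm T, of "x - \<epsilon>"]]
    unfolding esd_eq_card[OF H(1) l] esd_eq_card[OF G(1) m] by simp
  then show ?thesis
    unfolding levy_dist_def using \<epsilon> by (intro cInf_lower bdd_belowI[of _ 0]) auto
qed

subsection \<open>Comparison of the two quadratic forms\<close>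

text \<open>The term \<open>j = i\<close> contributes \<open>sgn 0 = 0\<close>, hence the denominator.\<close>

definition mean_sign :: "nat \<Rightarrow> (nat \<Rightarrow> nat \<Rightarrow> real) \<Rightarrow> nat \<Rightarrow> nat \<Rightarrow> real" where
  "mean_sign n X i a = (\<Sum>j<n. sgn (X i a - X j a)) / (real n - 1)"

text \<open>In the deterministic Levy bound below, the sample enters only through this
  quantity.\<close>

definition sign_error :: "nat \<Rightarrow> nat \<Rightarrow> (nat \<Rightarrow> nat \<Rightarrow> real) \<Rightarrow> real" where
  "sign_error n p X = (\<Sum>i<n. \<Sum>a<p. (mean_sign n X i a - (2 * Phi (X i a) - 1))\<^sup>2)"

lemma Phi_bounds: "0 \<le> Phi x" "Phi x \<le> 1"
proof -
  interpret prob_space "density lborel std_normal_density" by (rule prob_space_normal_density) simp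
  show "0 \<le> Phi x" "Phi x \<le> 1" unfolding Phi_def by (auto simp: prob_le_1)
qed

text \<open>At most \<open>n - 1\<close> of the signs are nonzero, since the one at
  \<open>j = i\<close> vanishes. For \<open>n = 1\<close> division by zero makes the mean 0.\<close>

lemma abs_mean_sign_le_1:
  assumes "i < n"
  shows "\<bar>mean_sign n X i a\<bar> \<le> 1"
proof (cases "n = 1")
  case False
  have "\<bar>\<Sum>j<n. sgn (X i a - X j a)\<bar> \<le> (\<Sum>j<n. \<bar>sgn (X i a - X j a)\<bar>)" by (rule sum_abs)
  also have "\<dots> \<le> (\<Sum>j<n. of_bool (j \<noteq> i))" by (intro sum_mono) (auto simp: sgn_if)
  also have "\<dots> = real n - 1"
    using assms by (simp add: of_bool_def sum.If_cases Collect_neg_eq Int_Diff card_Diff_singleton_if of_nat_diff flip: Diff_eq)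
  finally show ?thesis using assms False by (simp add: mean_sign_def field_simps)
qed (simp add: mean_sign_def)

text \<open>The quadratic form of a sum of rank-one matrices is a sum of products of inner products.
  The index set is left general to cover both single indices, for \<open>W_mat\<close>, and triples,
  for \<open>rho_tilde\<close>.\<close>

lemma sum_mat_quad_form:
  fixes f :: "'i \<Rightarrow> nat \<Rightarrow> real"
  shows "(\<Sum>a<p. \<Sum>b<p. v a * (c * (\<Sum>i\<in>I. f i a * g i b)) * v b)
    = c * (\<Sum>i\<in>I. (\<Sum>a<p. v a * f i a) * (\<Sum>b<p. v b * g i b))"
proof -
  have "(\<Sum>a<p. \<Sum>b<p. v a * (c * (\<Sum>i\<in>I. f i a * g i b)) * v b)
     = (\<Sum>a<p. \<Sum>b<p. \<Sum>i\<in>I. c * ((v a * f i a) * (v b * g i b)))"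
    by (simp add: sum_distrib_left sum_distrib_right mult_ac)
  also have "\<dots> = (\<Sum>a<p. \<Sum>i\<in>I. \<Sum>b<p. c * ((v a * f i a) * (v b * g i b)))"
    by (intro sum.cong refl sum.swap)
  also have "\<dots> = (\<Sum>i\<in>I. \<Sum>a<p. \<Sum>b<p. c * ((v a * f i a) * (v b * g i b)))" by (rule sum.swap)
  also have "\<dots> = c * (\<Sum>i\<in>I. (\<Sum>a<p. v a * f i a) * (\<Sum>b<p. v b * g i b))"
    by (simp only: sum_product, simp only: sum_distrib_left)
  finally show ?thesis .
qed

lemma quad_form_W_mat:
  "quad_form p (W_mat n p X) v = 3 / real n * (\<Sum>i<n. (\<Sum>a<p. v a * (2 * Phi (X i a) - 1))\<^sup>2)"
  using sum_mat_quad_form[where I = "{..<n}" and c = "3 / real n" and p = p and v = v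
      and f = "\<lambda>i a. 2 * Phi (X i a) - 1" and g = "\<lambda>i a. 2 * Phi (X i a) - 1"]
  by (simp add: quad_form_def W_mat_def power2_eq_square)

text \<open>Triples with \<open>j = i\<close> or \<open>k = i\<close> contribute nothing because
  \<open>A i i = 0\<close>, so only the diagonal \<open>j = k\<close> has to be subtracted from the
  full square.\<close>

lemma sum_distinct_triples:
  fixes A :: "nat \<Rightarrow> nat \<Rightarrow> real"
  assumes "\<And>i. A i i = 0"
  shows "(\<Sum>(i, j, k) \<in> {(i, j, k). i < n \<and> j < n \<and> k < n \<and> i \<noteq> j \<and> i \<noteq> k \<and> j \<noteq> k}. A i j * A i k)
    = (\<Sum>i<n. (\<Sum>j<n. A i j)\<^sup>2) - (\<Sum>i<n. \<Sum>j<n. (A i j)\<^sup>2)"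
proof -
  let ?S = "{(i, j, k). i < n \<and> j < n \<and> k < n \<and> i \<noteq> j \<and> i \<noteq> k \<and> j \<noteq> k}"
  have "(\<Sum>(i, j, k) \<in> ?S. A i j * A i k)
      = (\<Sum>(i, j, k) \<in> {..<n} \<times> {..<n} \<times> {..<n}. of_bool (j \<noteq> k) * (A i j * A i k))"
    by (intro sum.mono_neutral_cong_left) (auto simp: assms)
  also have "\<dots> = (\<Sum>i<n. \<Sum>j<n. \<Sum>k<n. A i j * A i k - of_bool (j = k) * (A i j * A i k))"
    unfolding sum.cartesian_product by (intro sum.cong) auto
  also have "\<dots> = (\<Sum>i<n. (\<Sum>j<n. A i j)\<^sup>2) - (\<Sum>i<n. \<Sum>j<n. (A i j)\<^sup>2)"
    by (simp add: sum_subtractf power2_eq_square sum_product sum_of_bool_eq del: sum_of_bool_mult_eq)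
  finally show ?thesis .
qed

text \<open>Summing the signs over \<open>j\<close> gives \<open>n - 1\<close> times the mean sign;
  the resulting factor \<open>(n - 1)\<^sup>2\<close> changes the normalization of the leading term.
  The second term is the removed diagonal \<open>j = k\<close>.\<close>

lemma quad_form_rho_tilde:
  assumes "n \<ge> 3"
  shows "quad_form p (rho_tilde n p X) v =
    3 * (real n - 1) / (real n * (real n - 2)) * (\<Sum>i<n. (\<Sum>a<p. v a * mean_sign n X i a)\<^sup>2)
    - 3 / (real n * (real n - 1) * (real n - 2)) *
      (\<Sum>i<n. \<Sum>j<n. (\<Sum>a<p. v a * sgn (X i a - X j a))\<^sup>2)"
proof -
  define c where "c = 3 / (real n * (real n - 1) * (real n - 2))"
  define A where "A i j = (\<Sum>a<p. v a * sgn (X i a - X j a))" for i j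
  let ?S = "{(i, j, k). i < n \<and> j < n \<and> k < n \<and> i \<noteq> j \<and> i \<noteq> k \<and> j \<noteq> k}"
  have "quad_form p (rho_tilde n p X) v = c * (\<Sum>(i, j, k) \<in> ?S. A i j * A i k)"
    using sum_mat_quad_form[where I = ?S and c = c and p = p and v = v
        and f = "\<lambda>(i, j, k) a. sgn (X i a - X j a)" and g = "\<lambda>(i, j, k) a. sgn (X i a - X k a)"]
    by (simp add: quad_form_def rho_tilde_def A_def c_def case_prod_unfold)
  also have "(\<Sum>(i, j, k) \<in> ?S. A i j * A i k) = (\<Sum>i<n. (\<Sum>j<n. A i j)\<^sup>2) - (\<Sum>i<n. \<Sum>j<n. (A i j)\<^sup>2)"
    by (rule sum_distinct_triples) (simp add: A_def)
  also have "(\<Sum>i<n. (\<Sum>j<n. A i j)\<^sup>2) = (real n - 1)\<^sup>2 * (\<Sum>i<n. (\<Sum>a<p. v a * mean_sign n X i a)\<^sup>2)"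
  proof -
    have "(\<Sum>j<n. A i j) = (real n - 1) * (\<Sum>a<p. v a * mean_sign n X i a)" for i
    proof -
      have "(\<Sum>j<n. A i j) = (\<Sum>a<p. v a * (\<Sum>j<n. sgn (X i a - X j a)))"
        unfolding A_def sum_distrib_left by (rule sum.swap)
      also have "\<dots> = (\<Sum>a<p. v a * ((real n - 1) * mean_sign n X i a))"
        using assms by (simp add: mean_sign_def)
      finally show ?thesis by (simp add: sum_distrib_left mult_ac)
    qed
    then show ?thesis by (simp only: power_mult_distrib sum_distrib_left[symmetric])
  qed
  also have "c * ((real n - 1)\<^sup>2 * (\<Sum>i<n. (\<Sum>a<p. v a * mean_sign n X i a)\<^sup>2) - (\<Sum>i<n. \<Sum>j<n. (A i j)\<^sup>2))
    = 3 * (real n - 1) / (real n * (real n - 2)) * (\<Sum>i<n. (\<Sum>a<p. v a * mean_sign n X i a)\<^sup>2)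
      - c * (\<Sum>i<n. \<Sum>j<n. (A i j)\<^sup>2)"
  proof -
    have "c * (real n - 1)\<^sup>2 = 3 * (real n - 1) / (real n * (real n - 2))"
      using assms by (simp add: c_def power2_eq_square)
    then show ?thesis by (simp only: right_diff_distrib mult.assoc[symmetric])
  qed
  finally show ?thesis unfolding A_def c_def .
qed

lemma bessel_le_dim:
  assumes "orthonormal_basis p u" "K \<subseteq> {..<p}" "\<And>a. a < p \<Longrightarrow> \<bar>w a\<bar> \<le> r"
  shows "(\<Sum>k\<in>K. (\<Sum>a<p. u k a * w a)\<^sup>2) \<le> r\<^sup>2 * real p"
proof -
  have "(\<Sum>k\<in>K. (\<Sum>a<p. u k a * w a)\<^sup>2) \<le> (\<Sum>a<p. (w a)\<^sup>2)" by (rule bessel[OF assms(1,2)])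
  also have "\<dots> \<le> (\<Sum>a<p. r\<^sup>2)" using assms(3) by (intro sum_mono abs_le_square_iff[THEN iffD1]) fastforce
  finally show ?thesis by (simp add: mult.commute)
qed

text \<open>The arithmetic-geometric mean inequality for |x - y| and t |x + y|. The free weight
  \<open>t\<close> later balances a small difference against a merely bounded sum.\<close>

lemma diff_squares_le:
  fixes x y t :: real
  assumes "t > 0"
  shows "\<bar>x\<^sup>2 - y\<^sup>2\<bar> \<le> (x - y)\<^sup>2 / (2 * t) + t / 2 * (x + y)\<^sup>2"
proof -
  have "2 * t * \<bar>x\<^sup>2 - y\<^sup>2\<bar> = 2 * \<bar>x - y\<bar> * (t * \<bar>x + y\<bar>)"
    using assms by (simp add: power2_eq_square abs_mult square_diff_square_factored)
  also have "\<dots> \<le> (x - y)\<^sup>2 + t\<^sup>2 * (x + y)\<^sup>2"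
    using sum_squares_bound[of "\<bar>x - y\<bar>" "t * \<bar>x + y\<bar>"] by (simp add: power_mult_distrib)
  finally show ?thesis using assms by (simp add: field_simps power2_eq_square)
qed

text \<open>The difference splits into three parts: replacing mean signs by their conditional means,
  the change of normalization from \<open>c\<close> to \<open>3 / n\<close>, and the diagonal
  \<open>j = k\<close>. The last two contribute at most \<open>3 * p / (n - 2)\<close> and
  \<open>6 * p / (n - 2)\<close>.\<close>

lemma rho_tilde_W_mat_orthonormal_bound:
  assumes n: "n \<ge> 3" and t: "t > 0" and u: "orthonormal_basis p u" and K: "K \<subseteq> {..<p}"
  shows "\<bar>\<Sum>k\<in>K. quad_form p (rho_tilde n p X) (u k) - quad_form p (W_mat n p X) (u k)\<bar>
    \<le> 3 * sign_error n p X / (real n * t) + 12 * t * real p + 9 * real p / (real n - 2)"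
proof -
  define c where "c = 3 * (real n - 1) / (real n * (real n - 2))"
  define c' where "c' = 3 / (real n * (real n - 1) * (real n - 2))"
  define S where "S i k = (\<Sum>a<p. u k a * mean_sign n X i a)" for i k
  define A where "A i k = (\<Sum>a<p. u k a * (2 * Phi (X i a) - 1))" for i k
  define B where "B i j k = (\<Sum>a<p. u k a * sgn (X i a - X j a))" for i j k
  have c0: "0 \<le> c" "0 \<le> c'" using n by (auto simp: c_def c'_def)
  have c: "c \<le> 6 / real n" "c - 3 / real n = 3 / (real n * (real n - 2))"
    using n by (simp_all add: c_def field_simps)
  have c': "c' * (real n * real n) \<le> 6 / (real n - 2)"
  proof -
    have "c' * (real n * real n) = 3 * (real n / (real n - 1)) / (real n - 2)"
      by (simp add: c'_def)
    also have "\<dots> \<le> 3 * 2 / (real n - 2)"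
      using n by (intro divide_right_mono mult_left_mono) (simp_all add: field_simps)
    finally show ?thesis by simp
  qed
  have A_le: "(\<Sum>k\<in>K. (A i k)\<^sup>2) \<le> real p" for i
    using bessel_le_dim[OF u K, of "\<lambda>a. 2 * Phi (X i a) - 1" 1] Phi_bounds[of "X i _"]
    unfolding A_def by (simp add: abs_le_iff)
  have B_le: "(\<Sum>k\<in>K. (B i j k)\<^sup>2) \<le> real p" for i j
    using bessel_le_dim[OF u K, of "\<lambda>a. sgn (X i a - X j a)" 1]
    unfolding B_def by (simp add: abs_sgn_eq)
  have SA_le: "(\<Sum>k\<in>K. (S i k + A i k)\<^sup>2) \<le> 4 * real p" if "i < n" for i
  proof -
    have "\<bar>mean_sign n X i a + (2 * Phi (X i a) - 1)\<bar> \<le> 2" for a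
      using abs_mean_sign_le_1[OF that, of X a] Phi_bounds[of "X i a"] by linarith
    from bessel_le_dim[OF u K, of "\<lambda>a. mean_sign n X i a + (2 * Phi (X i a) - 1)", OF this]
    show ?thesis unfolding S_def A_def by (simp add: distrib_left flip: sum.distrib)
  qed
  have D_le: "(\<Sum>i<n. \<Sum>k\<in>K. (S i k - A i k)\<^sup>2) \<le> sign_error n p X"
    unfolding sign_error_def
  proof (rule sum_mono)
    fix i
    show "(\<Sum>k\<in>K. (S i k - A i k)\<^sup>2) \<le> (\<Sum>a<p. (mean_sign n X i a - (2 * Phi (X i a) - 1))\<^sup>2)"
      using bessel[OF u K, of "\<lambda>a. mean_sign n X i a - (2 * Phi (X i a) - 1)"]
      unfolding S_def A_def by (simp add: right_diff_distrib flip: sum_subtractf)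
  qed
  have "(\<Sum>k\<in>K. quad_form p (rho_tilde n p X) (u k) - quad_form p (W_mat n p X) (u k))
    = (\<Sum>k\<in>K. c * (\<Sum>i<n. (S i k)\<^sup>2 - (A i k)\<^sup>2) + (c - 3 / real n) * (\<Sum>i<n. (A i k)\<^sup>2)
        - c' * (\<Sum>i<n. \<Sum>j<n. (B i j k)\<^sup>2))"
    unfolding quad_form_rho_tilde[OF n] quad_form_W_mat c_def[symmetric] c'_def[symmetric]
      S_def[symmetric] A_def[symmetric] B_def[symmetric]
    by (intro sum.cong refl) (simp add: sum_subtractf algebra_simps)
  also have "\<dots> = c * (\<Sum>i<n. \<Sum>k\<in>K. (S i k)\<^sup>2 - (A i k)\<^sup>2)
      + (c - 3 / real n) * (\<Sum>i<n. \<Sum>k\<in>K. (A i k)\<^sup>2) - c' * (\<Sum>i<n. \<Sum>j<n. \<Sum>k\<in>K. (B i j k)\<^sup>2)"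
    unfolding sum.distrib sum_subtractf[of "\<lambda>k. _ k + _ k"] sum_distrib_left[symmetric]
      sum.swap[of _ K "{..<n}"] ..
  finally have eq: "(\<Sum>k\<in>K. quad_form p (rho_tilde n p X) (u k) - quad_form p (W_mat n p X) (u k)) = \<dots>" .
  have first: "\<bar>c * (\<Sum>i<n. \<Sum>k\<in>K. (S i k)\<^sup>2 - (A i k)\<^sup>2)\<bar> \<le> 3 * sign_error n p X / (real n * t) + 12 * t * real p"
  proof -
    have "\<bar>\<Sum>i<n. \<Sum>k\<in>K. (S i k)\<^sup>2 - (A i k)\<^sup>2\<bar> \<le> (\<Sum>i<n. \<Sum>k\<in>K. \<bar>(S i k)\<^sup>2 - (A i k)\<^sup>2\<bar>)"
      by (intro order_trans[OF sum_abs] sum_mono sum_abs)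
    \<comment> \<open>The squared differences sum to at most \<open>sign_error\<close>; the sums
      have coordinates bounded by 2, which costs \<open>4 * p\<close> for each
      \<open>i\<close>.\<close>
    also have "\<dots> \<le> (\<Sum>i<n. \<Sum>k\<in>K. (S i k - A i k)\<^sup>2 / (2 * t) + t / 2 * (S i k + A i k)\<^sup>2)"
      by (intro sum_mono diff_squares_le t)
    also have "\<dots> = (\<Sum>i<n. \<Sum>k\<in>K. (S i k - A i k)\<^sup>2) / (2 * t) + t / 2 * (\<Sum>i<n. \<Sum>k\<in>K. (S i k + A i k)\<^sup>2)"
      by (simp only: sum.distrib sum_divide_distrib sum_distrib_left)
    also have "\<dots> \<le> sign_error n p X / (2 * t) + t / 2 * (\<Sum>i<n. 4 * real p)"
      using t D_le SA_le by (intro add_mono divide_right_mono mult_left_mono sum_mono) auto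
    finally have *: "\<bar>\<Sum>i<n. \<Sum>k\<in>K. (S i k)\<^sup>2 - (A i k)\<^sup>2\<bar> \<le> sign_error n p X / (2 * t) + 2 * t * real n * real p"
      by simp
    have "\<bar>c * (\<Sum>i<n. \<Sum>k\<in>K. (S i k)\<^sup>2 - (A i k)\<^sup>2)\<bar>
      \<le> 6 / real n * (sign_error n p X / (2 * t) + 2 * t * real n * real p)"
      unfolding abs_mult using c(1) c0(1) n by (intro mult_mono *) auto
    also have "\<dots> = 3 * sign_error n p X / (real n * t) + 12 * t * real p"
      using n t by (simp add: field_simps)
    finally show ?thesis .
  qed
  have "0 \<le> (\<Sum>i<n. \<Sum>k\<in>K. (A i k)\<^sup>2)" "(\<Sum>i<n. \<Sum>k\<in>K. (A i k)\<^sup>2) \<le> real n * real p"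
    using sum_mono[of "{..<n}" "\<lambda>i. \<Sum>k\<in>K. (A i k)\<^sup>2" "\<lambda>_. real p"] A_le by (simp_all add: sum_nonneg)
  then have second: "0 \<le> (c - 3 / real n) * (\<Sum>i<n. \<Sum>k\<in>K. (A i k)\<^sup>2)"
    "(c - 3 / real n) * (\<Sum>i<n. \<Sum>k\<in>K. (A i k)\<^sup>2) \<le> 3 * real p / (real n - 2)"
    using n mult_left_mono[of "\<Sum>i<n. \<Sum>k\<in>K. (A i k)\<^sup>2" "real n * real p" "3 / (real n * (real n - 2))"]
    unfolding c(2) by simp_all
  have "(\<Sum>i<n. \<Sum>j<n. \<Sum>k\<in>K. (B i j k)\<^sup>2) \<le> (\<Sum>i<n. \<Sum>j<n. real p)"
    by (intro sum_mono B_le)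
  then have "c' * (\<Sum>i<n. \<Sum>j<n. \<Sum>k\<in>K. (B i j k)\<^sup>2) \<le> c' * (real n * real n) * real p"
    using c0(2) by (simp add: mult_left_mono mult.assoc)
  also have "\<dots> \<le> 6 / (real n - 2) * real p" by (intro mult_right_mono c') simp
  finally have third: "c' * (\<Sum>i<n. \<Sum>j<n. \<Sum>k\<in>K. (B i j k)\<^sup>2) \<le> 6 * real p / (real n - 2)" by simp
  have third0: "0 \<le> c' * (\<Sum>i<n. \<Sum>j<n. \<Sum>k\<in>K. (B i j k)\<^sup>2)"
    using c0(2) by (simp add: sum_nonneg)
  have "9 * real p / (real n - 2) = 3 * real p / (real n - 2) + 6 * real p / (real n - 2)"
    by (simp flip: add_divide_distrib)
  then show ?thesis unfolding eq using first second third third0 by linarith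
qed

text \<open>The constants make each of the three terms of the preceding bound at most \<epsilon>^2 p
  / 6, so that twice their sum is at most \<epsilon>^2 p: \<open>t\<close> settles the middle term,
  54 = 9 * 6 the last one, and 1296 = 3 * 72 * 6 the one with \<open>sign_error\<close>.\<close>

lemma levy_dist_rho_tilde_W_mat_le:
  assumes \<epsilon>: "\<epsilon> > 0" and n: "n \<ge> 3" "54 \<le> \<epsilon>\<^sup>2 * (real n - 2)"
    and R: "sign_error n p X \<le> \<epsilon> ^ 4 / 1296 * real n * real p"
  shows "levy_dist (esd (rho_tilde n p X)) (esd (W_mat n p X)) \<le> \<epsilon>"
proof -
  define t where "t = \<epsilon>\<^sup>2 / 72"
  have t: "t > 0" using \<epsilon> by (simp add: t_def)
  show ?thesis
  proof (rule levy_dist_esd_le[where n = p and T = "3 * sign_error n p X / (real n * t) + 12 * t * real p + 9 * real p / (real n - 2)"])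
    show "rho_tilde n p X \<in> carrier_mat p p" "W_mat n p X \<in> carrier_mat p p"
      by (simp_all add: rho_tilde_def W_mat_def)
    show "transpose_mat (W_mat n p X) = W_mat n p X"
      by (rule eq_matI) (auto simp: W_mat_def mult.commute)
    show "transpose_mat (rho_tilde n p X) = rho_tilde n p X"
    proof (rule eq_matI)
      fix a b assume "a < dim_row (rho_tilde n p X)" "b < dim_col (rho_tilde n p X)"
      \<comment> \<open>Transposition exchanges the roles of \<open>j\<close> and \<open>k\<close>,
        and the set of distinct triples is invariant under this exchange.\<close>
      moreover have "(\<Sum>(i, j, k) \<in> {(i, j, k). i < n \<and> j < n \<and> k < n \<and> i \<noteq> j \<and> i \<noteq> k \<and> j \<noteq> k}.
          sgn (X i b - X j b) * sgn (X i a - X k a))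
        = (\<Sum>(i, j, k) \<in> {(i, j, k). i < n \<and> j < n \<and> k < n \<and> i \<noteq> j \<and> i \<noteq> k \<and> j \<noteq> k}.
          sgn (X i a - X j a) * sgn (X i b - X k b))"
        by (rule sum.reindex_bij_witness[of _ "\<lambda>(i, j, k). (i, k, j)" "\<lambda>(i, j, k). (i, k, j)"]) auto
      ultimately show "transpose_mat (rho_tilde n p X) $$ (a, b) = rho_tilde n p X $$ (a, b)"
        by (simp add: rho_tilde_def)
    qed (simp_all add: rho_tilde_def)
    have "3 * sign_error n p X / (real n * t) \<le> 3 * (\<epsilon> ^ 4 / 1296 * real n * real p) / (real n * t)"
      using R n t by (intro divide_right_mono mult_left_mono) auto
    also have "\<dots> = \<epsilon>\<^sup>2 * real p / 6"
      using n \<epsilon> by (simp add: t_def field_simps power2_eq_square power4_eq_xxxx)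
    finally have 1: "3 * sign_error n p X / (real n * t) \<le> \<epsilon>\<^sup>2 * real p / 6" .
    have "9 / (real n - 2) \<le> \<epsilon>\<^sup>2 / 6" using n by (simp add: field_simps)
    then have "9 / (real n - 2) * real p \<le> \<epsilon>\<^sup>2 / 6 * real p" by (intro mult_right_mono) auto
    then have 2: "9 * real p / (real n - 2) \<le> \<epsilon>\<^sup>2 * real p / 6" by simp
    have 3: "12 * t * real p = \<epsilon>\<^sup>2 * real p / 6" by (simp add: t_def)
    have "2 * (3 * sign_error n p X / (real n * t) + 12 * t * real p + 9 * real p / (real n - 2))
      \<le> 2 * (\<epsilon>\<^sup>2 * real p / 6 + \<epsilon>\<^sup>2 * real p / 6 + \<epsilon>\<^sup>2 * real p / 6)"
      by (intro mult_left_mono add_mono 1 2 eq_refl[OF 3]) simp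
    also have "\<dots> = \<epsilon>\<^sup>2 * real p" by simp
    finally show "2 * (3 * sign_error n p X / (real n * t) + 12 * t * real p + 9 * real p / (real n - 2))
      \<le> \<epsilon>\<^sup>2 * real p" .
  qed (use \<epsilon> rho_tilde_W_mat_orthonormal_bound[OF n(1) t] in auto)
qed

subsection \<open>Concentration of the mean signs\<close>

lemma borel_measurable_Phi [measurable]: "Phi \<in> borel_measurable borel"
proof (rule borel_measurable_mono)
  interpret prob_space "density lborel std_normal_density" by (rule prob_space_normal_density) simp
  show "mono Phi" unfolding Phi_def by (intro monoI finite_measure_mono) auto
qed

text \<open>The sign minus its conditional mean given the first argument, for a standard normal
  second argument.\<close>

definition centered_sgn :: "real \<Rightarrow> real \<Rightarrow> real" where
  "centered_sgn x y = sgn (x - y) - (2 * Phi x - 1)"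

lemma measurable_centered_sgn [measurable]:
  "(\<lambda>(x, y). centered_sgn x y) \<in> borel_measurable (borel \<Otimes>\<^sub>M borel)"
  unfolding centered_sgn_def by measurable

lemma abs_centered_sgn_le_2: "\<bar>centered_sgn x y\<bar> \<le> 2"
  using Phi_bounds[of x] by (auto simp: centered_sgn_def sgn_if abs_le_iff)

text \<open>The normal law has no atom at \<open>x\<close>, so the sign is almost surely twice the
  indicator of y \<le> x, minus 1.\<close>

lemma integral_centered_sgn:
  "(\<integral>y. centered_sgn x y \<partial>density lborel std_normal_density) = 0"
proof -
  let ?N = "density lborel std_normal_density"
  interpret N: prob_space ?N by (rule prob_space_normal_density) simp
  have null: "AE y in ?N. y \<noteq> x"
    by (subst AE_density) (auto intro: AE_mp[OF AE_lborel_singleton[of x]])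
  have "(\<integral>y. sgn (x - y) \<partial>?N) = (\<integral>y. 2 * indicator {..x} y - 1 \<partial>?N)"
    using null by (intro integral_cong_AE) (auto simp: sgn_if indicator_def elim!: eventually_mono)
  also have "\<dots> = 2 * Phi x - 1"
  proof -
    have "integrable ?N (indicat_real {..x})" by (rule N.integrable_const_bound[of _ 1]) auto
    then show ?thesis using N.prob_space by (simp add: Phi_def)
  qed
  finally have "(\<integral>y. sgn (x - y) \<partial>?N) = 2 * Phi x - 1" .
  moreover have "integrable ?N (\<lambda>y. sgn (x - y))"
    by (rule N.integrable_const_bound[of _ 1]) (auto simp: abs_sgn_eq)
  ultimately show ?thesis unfolding centered_sgn_def using N.prob_space by simp
qed

context prob_space
begin

text \<open>\<open>Y k\<close> is independent of the pair \<open>Y i\<close>, \<open>Y j\<close>. By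
  Fubini's theorem it can be integrated out first, and this inner integral is already 0.\<close>

lemma expectation_centered_sgn_cross:
  fixes Y :: "'i \<Rightarrow> 'a \<Rightarrow> real"
  assumes indep: "indep_vars (\<lambda>_. borel) Y I"
    and ijk: "i \<in> I" "j \<in> I" "k \<in> I" "k \<noteq> i" "k \<noteq> j"
    and k: "distributed M lborel (Y k) std_normal_density"
  shows "expectation (\<lambda>\<omega>. centered_sgn (Y i \<omega>) (Y j \<omega>) * centered_sgn (Y i \<omega>) (Y k \<omega>)) = 0"
proof -
  have [measurable]: "random_variable borel (Y i)" "random_variable borel (Y j)" "random_variable borel (Y k)"
    using indep ijk unfolding indep_vars_def by auto
  let ?P = "PiM {i, j} (\<lambda>_. borel) :: ('i \<Rightarrow> real) measure"
    and ?Q = "PiM {k} (\<lambda>_. borel) :: ('i \<Rightarrow> real) measure"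
  let ?U = "\<lambda>\<omega>. restrict (\<lambda>i. Y i \<omega>) {i, j}" and ?V = "\<lambda>\<omega>. restrict (\<lambda>i. Y i \<omega>) {k}"
  have "indep_var ?P ?U ?Q ?V"
    using ijk by (intro indep_var_restrict[OF indep]) auto
  then have [measurable]: "random_variable ?P ?U" "random_variable ?Q ?V"
    and prod: "distr M ?P ?U \<Otimes>\<^sub>M distr M ?Q ?V = distr M (?P \<Otimes>\<^sub>M ?Q) (\<lambda>\<omega>. (?U \<omega>, ?V \<omega>))"
    unfolding indep_var_distribution_eq by auto
  interpret U: prob_space "distr M ?P ?U" by (rule prob_space_distr) simp
  interpret V: prob_space "distr M ?Q ?V" by (rule prob_space_distr) simp
  interpret UV: pair_prob_space "distr M ?P ?U" "distr M ?Q ?V" ..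
  let ?f = "\<lambda>(u, v). centered_sgn (u i) (u j) * centered_sgn (u i) (v k)"
  have f [measurable]: "?f \<in> borel_measurable (?P \<Otimes>\<^sub>M ?Q)"
    by measurable
  have inner: "(\<integral>v. ?f (u, v) \<partial>distr M ?Q ?V) = 0" for u
  proof -
    have N: "distr M lborel (Y k) = density lborel std_normal_density"
      using distributed_distr_eq_density[OF k] by simp
    have "(\<integral>v. centered_sgn (u i) (v k) \<partial>distr M ?Q ?V) = (\<integral>y. centered_sgn (u i) y \<partial>distr M lborel (Y k))"
      by (subst (1 2) integral_distr) simp_all
    then show ?thesis by (simp add: N integral_centered_sgn)
  qed
  have "expectation (\<lambda>\<omega>. centered_sgn (Y i \<omega>) (Y j \<omega>) * centered_sgn (Y i \<omega>) (Y k \<omega>))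
    = integral\<^sup>L (distr M ?P ?U \<Otimes>\<^sub>M distr M ?Q ?V) ?f"
    unfolding prod by (subst integral_distr) simp_all
  also have "\<dots> = (\<integral>u. (\<integral>v. ?f (u, v) \<partial>distr M ?Q ?V) \<partial>distr M ?P ?U)"
  proof (rule UV.integral_fst'[symmetric], rule UV.P.integrable_const_bound[of _ 4])
    have "\<bar>centered_sgn x y * centered_sgn x z\<bar> \<le> 2 * 2" for x y z
      unfolding abs_mult by (intro mult_mono abs_centered_sgn_le_2) auto
    then show "AE w in distr M ?P ?U \<Otimes>\<^sub>M distr M ?Q ?V. norm (?f w) \<le> 4"
      by (simp add: case_prod_unfold)
  qed simp
  also have "\<dots> = 0" unfolding inner by simp
  finally show ?thesis .
qed

text \<open>Each deviation is an average of \<open>n - 1\<close> centered signs. After squaring, the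
  cross terms have expectation 0 and each of the \<open>n - 1\<close> diagonal terms is at most 4,
  so every pair \<open>i\<close>, \<open>a\<close> contributes at most
  \<open>4 / (n - 1)\<close>.\<close>

lemma expectation_sign_error_le:
  fixes Y :: "nat \<Rightarrow> nat \<Rightarrow> 'a \<Rightarrow> real"
  assumes n: "n \<ge> 2"
    and indep: "\<And>a. a < p \<Longrightarrow> indep_vars (\<lambda>_. borel) (\<lambda>i. Y i a) {..<n}"
    and normal: "\<And>i a. i < n \<Longrightarrow> a < p \<Longrightarrow> distributed M lborel (Y i a) std_normal_density"
  shows "integrable M (\<lambda>\<omega>. sign_error n p (\<lambda>i a. Y i a \<omega>))"
    and "expectation (\<lambda>\<omega>. sign_error n p (\<lambda>i a. Y i a \<omega>)) \<le> 4 * real n * real p / (real n - 1)"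
proof -
  have rv [measurable]: "random_variable borel (Y i a)" if "i < n" "a < p" for i a
    using distributed_measurable[OF normal[OF that]] by simp
  define g where "g i a j \<omega> = centered_sgn (Y i a \<omega>) (Y j a \<omega>)" for i a j \<omega>
  \<comment> \<open>The index \<open>j = i\<close> is excluded because there the sign is 0 but
    \<open>centered_sgn\<close> in general is not.\<close>
  define J where "J i = {..<n} - {i}" for i
  have card_J: "real (card (J i)) = real n - 1" if "i < n" for i
    using that by (simp add: J_def of_nat_diff)
  have gg_int: "integrable M (\<lambda>\<omega>. g i a j \<omega> * g i a k \<omega>)" if "i < n" "a < p" "j \<in> J i" "k \<in> J i" for i a j k
  proof (rule integrable_const_bound[of _ 4])
    have "\<bar>g i a j \<omega> * g i a k \<omega>\<bar> \<le> 2 * 2" for \<omega>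
      unfolding abs_mult g_def by (intro mult_mono abs_centered_sgn_le_2) auto
    then show "AE \<omega> in M. norm (g i a j \<omega> * g i a k \<omega>) \<le> 4" by simp
    have [measurable]: "random_variable borel (Y i a)" "random_variable borel (Y j a)" "random_variable borel (Y k a)"
      using that rv by (auto simp: J_def)
    show "random_variable borel (\<lambda>\<omega>. g i a j \<omega> * g i a k \<omega>)" unfolding g_def by measurable
  qed
  have gg_exp: "expectation (\<lambda>\<omega>. g i a j \<omega> * g i a k \<omega>) \<le> (if j = k then 4 else 0)"
    if "i < n" "a < p" "j \<in> J i" "k \<in> J i" for i a j k
  proof (cases "j = k")
    case True
    have "\<bar>g i a j \<omega>\<bar> \<le> 2" for \<omega> unfolding g_def by (rule abs_centered_sgn_le_2)
    then have "g i a j \<omega> * g i a k \<omega> \<le> 4" for \<omega>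
      using True abs_le_square_iff[of "g i a j \<omega>" 2] by (simp add: power2_eq_square)
    then have "expectation (\<lambda>\<omega>. g i a j \<omega> * g i a k \<omega>) \<le> expectation (\<lambda>_. 4)"
      by (intro integral_mono gg_int that) auto
    then show ?thesis using True by (simp add: prob_space)
  next
    case False
    then show ?thesis
      using that expectation_centered_sgn_cross[OF indep[of a], of i j k] normal[of k a]
      by (simp add: g_def J_def)
  qed
  have error: "sign_error n p (\<lambda>i a. Y i a \<omega>)
    = (\<Sum>i<n. \<Sum>a<p. (\<Sum>j\<in>J i. \<Sum>k\<in>J i. g i a j \<omega> * g i a k \<omega>) / (real n - 1)\<^sup>2)" for \<omega>
    unfolding sign_error_def
  proof (intro sum.cong refl)
    fix i a assume "i \<in> {..<n}"
    then have i: "i < n" by simp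
    have "(\<Sum>j<n. sgn (Y i a \<omega> - Y j a \<omega>)) = (\<Sum>j\<in>J i. sgn (Y i a \<omega> - Y j a \<omega>))"
      unfolding J_def by (rule sum.mono_neutral_right) auto
    also have "\<dots> = (\<Sum>j\<in>J i. g i a j \<omega>) + (real n - 1) * (2 * Phi (Y i a \<omega>) - 1)"
      by (simp add: g_def centered_sgn_def sum_subtractf card_J[OF i])
    finally have "mean_sign n (\<lambda>i a. Y i a \<omega>) i a - (2 * Phi (Y i a \<omega>) - 1) = (\<Sum>j\<in>J i. g i a j \<omega>) / (real n - 1)"
      using n by (simp add: mean_sign_def add_divide_distrib)
    then show "(mean_sign n (\<lambda>i a. Y i a \<omega>) i a - (2 * Phi (Y i a \<omega>) - 1))\<^sup>2
      = (\<Sum>j\<in>J i. \<Sum>k\<in>J i. g i a j \<omega> * g i a k \<omega>) / (real n - 1)\<^sup>2"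
      by (simp add: power_divide sum_product power2_eq_square)
  qed
  define h where "h i a \<omega> = (\<Sum>j\<in>J i. \<Sum>k\<in>J i. g i a j \<omega> * g i a k \<omega>) / (real n - 1)\<^sup>2" for i a \<omega>
  have h_int: "integrable M (h i a)"
    and h_exp: "expectation (h i a)
      = (\<Sum>j\<in>J i. \<Sum>k\<in>J i. expectation (\<lambda>\<omega>. g i a j \<omega> * g i a k \<omega>)) / (real n - 1)\<^sup>2"
    if "i < n" "a < p" for i a
    using gg_int[OF that] unfolding h_def by (simp_all add: Bochner_Integration.integral_sum)
  show "integrable M (\<lambda>\<omega>. sign_error n p (\<lambda>i a. Y i a \<omega>))"
    unfolding error h_def[symmetric] by (intro Bochner_Integration.integrable_sum h_int) auto
  have "expectation (\<lambda>\<omega>. sign_error n p (\<lambda>i a. Y i a \<omega>)) = (\<Sum>i<n. \<Sum>a<p. expectation (h i a))"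
  proof -
    have "expectation (\<lambda>\<omega>. \<Sum>a<p. h i a \<omega>) = (\<Sum>a<p. expectation (h i a))" if "i < n" for i
      by (rule Bochner_Integration.integral_sum) (use h_int that in auto)
    moreover have "expectation (\<lambda>\<omega>. \<Sum>i<n. \<Sum>a<p. h i a \<omega>) = (\<Sum>i<n. expectation (\<lambda>\<omega>. \<Sum>a<p. h i a \<omega>))"
      by (intro Bochner_Integration.integral_sum Bochner_Integration.integrable_sum h_int) auto
    ultimately show ?thesis unfolding error h_def[symmetric] by simp
  qed
  also have "\<dots> = (\<Sum>i<n. \<Sum>a<p. (\<Sum>j\<in>J i. \<Sum>k\<in>J i. expectation (\<lambda>\<omega>. g i a j \<omega> * g i a k \<omega>)) / (real n - 1)\<^sup>2)"
    by (intro sum.cong refl h_exp) auto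
  also have "\<dots> \<le> (\<Sum>i<n. \<Sum>a<p. (\<Sum>j\<in>J i. \<Sum>k\<in>J i. if j = k then 4 else 0) / (real n - 1)\<^sup>2)"
    by (intro sum_mono divide_right_mono gg_exp) auto
  also have "\<dots> = (\<Sum>i<n. \<Sum>a<p. 4 / (real n - 1))"
  proof (intro sum.cong refl)
    fix i assume "i \<in> {..<n}"
    moreover have "finite (J i)" by (simp add: J_def)
    ultimately show "(\<Sum>j\<in>J i. \<Sum>k\<in>J i. if j = k then 4 else 0) / (real n - 1)\<^sup>2 = 4 / (real n - 1)"
      using card_J[of i] n by (simp add: power2_eq_square divide_simps)
  qed
  also have "\<dots> = 4 * real n * real p / (real n - 1)" by simp
  finally show "expectation (\<lambda>\<omega>. sign_error n p (\<lambda>i a. Y i a \<omega>)) \<le> 4 * real n * real p / (real n - 1)" .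
qed

text \<open>Markov's inequality applied to \<open>sign_error\<close>: a Levy distance above
  \<epsilon> forces it over the threshold \<open>c\<close>. The factors \<open>n\<close> and
  \<open>p\<close> cancel, leaving 5184 = 4 * 1296.\<close>

lemma prob_levy_dist_rho_tilde_W_mat:
  fixes Y :: "nat \<Rightarrow> nat \<Rightarrow> 'a \<Rightarrow> real"
  assumes \<epsilon>: "\<epsilon> > 0" and n: "n \<ge> 3" "54 \<le> \<epsilon>\<^sup>2 * (real n - 2)" and p: "p > 0"
    and indep: "\<And>a. a < p \<Longrightarrow> indep_vars (\<lambda>_. borel) (\<lambda>i. Y i a) {..<n}"
    and normal: "\<And>i a. i < n \<Longrightarrow> a < p \<Longrightarrow> distributed M lborel (Y i a) std_normal_density"
  shows "prob {\<omega> \<in> space M. levy_dist (esd (rho_tilde n p (\<lambda>i a. Y i a \<omega>)))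
      (esd (W_mat n p (\<lambda>i a. Y i a \<omega>))) > \<epsilon>} \<le> 5184 / (\<epsilon> ^ 4 * (real n - 1))"
proof -
  let ?R = "\<lambda>\<omega>. sign_error n p (\<lambda>i a. Y i a \<omega>)"
  define c where "c = \<epsilon> ^ 4 / 1296 * real n * real p"
  have c: "c > 0" using \<epsilon> n p by (simp add: c_def)
  have n2: "n \<ge> 2" using n by simp
  note R = expectation_sign_error_le[of n p Y, OF n2 indep normal]
  have [measurable]: "random_variable borel ?R"
    using R(1) by (rule borel_measurable_integrable)
  have "prob {\<omega> \<in> space M. levy_dist (esd (rho_tilde n p (\<lambda>i a. Y i a \<omega>)))
      (esd (W_mat n p (\<lambda>i a. Y i a \<omega>))) > \<epsilon>} \<le> prob {\<omega> \<in> space M. ?R \<omega> \<ge> c}"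
  proof (rule finite_measure_mono) \<comment> \<open>a non-measurable set would have \<open>prob\<close> zero\<close>
    show "{\<omega> \<in> space M. levy_dist (esd (rho_tilde n p (\<lambda>i a. Y i a \<omega>)))
      (esd (W_mat n p (\<lambda>i a. Y i a \<omega>))) > \<epsilon>} \<subseteq> {\<omega> \<in> space M. ?R \<omega> \<ge> c}"
      using levy_dist_rho_tilde_W_mat_le[OF \<epsilon> n] unfolding c_def by (force simp: not_le[symmetric])
  qed measurable
  also have "\<dots> \<le> expectation ?R / c"
    using c by (intro integral_Markov_inequality_measure[where A = "{}"] R(1))
      (auto simp: sign_error_def sum_nonneg)
  also have "\<dots> \<le> 4 * real n * real p / (real n - 1) / c"
    using c R(2) by (intro divide_right_mono) auto
  also have "\<dots> = 5184 / (\<epsilon> ^ 4 * (real n - 1))"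
    using n p by (simp add: c_def)
  finally show ?thesis .
qed

end

section \<open>Convergence in probability\<close>

text \<open>Taking the coefficient vector to be the unit vector at \<open>a\<close> gives variance
  \<open>S a a = 1\<close>, which selects the nondegenerate alternative of the definition.\<close>

lemma centered_gaussian_vector_coordinate:
  assumes "centered_gaussian_vector M p S Y" "a < p" "S a a = 1"
  shows "distributed M lborel (Y a) std_normal_density"
proof -
  let ?c = "\<lambda>j. of_bool (j = a) :: real"
  have "(\<Sum>i<p. \<Sum>b<p. ?c i * S i b * ?c b) = 1"
    using assms(2,3) by (simp add: of_bool_def if_distrib[of "\<lambda>t. t * _"] if_distrib[of "\<lambda>t. _ * t"] cong: if_cong)
  moreover have "(\<Sum>j<p. ?c j * Y j \<omega>) = Y a \<omega>" for \<omega>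
    using sum_of_bool_eq(2)[OF assms(2)] .
  ultimately show ?thesis
    using assms(1) unfolding centered_gaussian_vector_def Let_def
    by (auto dest: spec[of _ ?c])
qed

theorem theorem1:
  fixes M :: "nat \<Rightarrow> 'a measure"
    and p :: "nat \<Rightarrow> nat"
    and \<Sigma> :: "nat \<Rightarrow> nat \<Rightarrow> nat \<Rightarrow> real"
    and X :: "nat \<Rightarrow> nat \<Rightarrow> nat \<Rightarrow> 'a \<Rightarrow> real"
    and y :: real
  assumes prob: "\<And>n. prob_space (M n)"
    and sym: "\<And>n a b. a < p n \<Longrightarrow> b < p n \<Longrightarrow> \<Sigma> n a b = \<Sigma> n b a"
    and diag: "\<And>n a. a < p n \<Longrightarrow> \<Sigma> n a a = 1"
    and gauss: "\<And>n i. i < n \<Longrightarrow> centered_gaussian_vector (M n) (p n) (\<Sigma> n) (X n i)"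
    and indep: "\<And>n. prob_space.indep_vars (M n) (\<lambda>i. PiM {..<p n} (\<lambda>_. borel))
                  (\<lambda>i \<omega>. \<lambda>a\<in>{..<p n}. X n i a \<omega>) {..<n}"
    and y_pos: "y > 0"
    and ratio: "(\<lambda>n. real (p n) / real n) \<longlonglongrightarrow> y"
    and trace: "(\<lambda>n. \<Sum>a<p n. \<Sum>b<p n. \<Sigma> n a b * \<Sigma> n b a) \<in> o(\<lambda>n. (real (p n))\<^sup>2)"
  shows "\<forall>\<epsilon>>0. (\<lambda>n. measure (M n) {\<omega> \<in> space (M n).
            levy_dist (esd (rho_tilde n (p n) (\<lambda>i a. X n i a \<omega>)))
                      (esd (W_mat n (p n) (\<lambda>i a. X n i a \<omega>))) > \<epsilon>}) \<longlonglongrightarrow> 0"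
proof (intro allI impI)
  fix \<epsilon> :: real
  assume \<epsilon>: "\<epsilon> > 0"
  let ?P = "\<lambda>n. measure (M n) {\<omega> \<in> space (M n).
    levy_dist (esd (rho_tilde n (p n) (\<lambda>i a. X n i a \<omega>)))
              (esd (W_mat n (p n) (\<lambda>i a. X n i a \<omega>))) > \<epsilon>}"
  have bound: "?P n \<le> 5184 / (\<epsilon> ^ 4 * (real n - 1))"
    if "n \<ge> 3" "54 \<le> \<epsilon>\<^sup>2 * (real n - 2)" "p n > 0" for n
  proof -
    interpret prob_space "M n" by (rule prob)
    \<comment> \<open>Projecting the independent vectors to coordinate \<open>a\<close> preserves
      independence over \<open>i\<close>.\<close>
    have "indep_vars (\<lambda>_. borel) (\<lambda>i. X n i a) {..<n}" if a: "a < p n" for a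
      using indep_vars_compose2[OF indep[of n], of "\<lambda>_ f. f a" "\<lambda>_. borel"] a by simp
    moreover have "distributed (M n) lborel (X n i a) std_normal_density" if "i < n" "a < p n" for i a
      using centered_gaussian_vector_coordinate[OF gauss[OF that(1)] that(2) diag[OF that(2)]] .
    ultimately show ?thesis by (intro prob_levy_dist_rho_tilde_W_mat \<epsilon> that)
  qed
  \<comment> \<open>A positive limit of the ratio excludes dimension 0 for large \<open>n\<close>,
    as the probability bound requires.\<close>
  have "eventually (\<lambda>n. real (p n) / real n > 0) sequentially"
    using order_tendstoD(1)[OF ratio y_pos] .
  then have "eventually (\<lambda>n. p n > 0) sequentially"
    by (rule eventually_mono) (auto intro: gr0I)
  moreover have "eventually (\<lambda>n. 54 \<le> \<epsilon>\<^sup>2 * (real n - 2)) sequentially"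
    using \<epsilon> by real_asymp
  ultimately have le: "eventually (\<lambda>n. ?P n \<le> 5184 / (\<epsilon> ^ 4 * (real n - 1))) sequentially"
    using eventually_ge_at_top[of 3] by eventually_elim (rule bound)
  have "(\<lambda>n. 5184 / (\<epsilon> ^ 4 * (real n - 1))) \<longlonglongrightarrow> 0"
    using \<epsilon> by real_asymp
  then show "?P \<longlonglongrightarrow> 0"
    by (intro tendsto_sandwich[OF always_eventually le tendsto_const]) auto
qed

end
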